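(* Assume that all the zeros of $f(z)=\sum_{i=0}^r a_iz^i\in\mathcal{H}_1(\mathbb{R})$ are nonpositive, that $F(z_1,\ldots,z_n)=\sum_{j=0}^s Q_j(z_2,\ldots,z_n)z_1^j\in\mathcal{H}_n(\mathbb{C})$, and set $m=\min(r,s)$. Then $$\sum_{k=0}^m k!\,a_k\,Q_k(z_2,\ldots,z_n)\,z_1^k\in\mathcal{H}_n(\mathbb{C})\cup\{0\}.$$
   Context: $\mathcal{H}_1(\mathbb{R})$ is the set of nonzero real univariate polynomials with only real zeros. $\mathcal{H}_n(\mathbb{C})$ is the set of stable polynomials in $n$ variables, i.e. polynomials $F\in\mathbb{C}[z_1,\ldots,z_n]$ with $F(z_1,\ldots,z_n)\neq 0$ whenever $\operatorname{Im}(z_j)>0$ for all $1\le j\le n$. The $Q_j$ are polynomials in $z_2,\ldots,z_n$. *)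

theory Defs
  imports
    Complex_Main
    "HOL-Library.Poly_Mapping"
    "HOL-Computational_Algebra.Polynomial"
begin

text \<open>
  A polynomial is a finitely supported map from monomials to coefficients, a monomial being a
  finitely supported map from variable indices to exponents; \<open>Poly_Mapping\<close> provides the
  commutative ring structure, with convolution as product.
\<close>

type_synonym cmpoly = "(nat \<Rightarrow>\<^sub>0 nat) \<Rightarrow>\<^sub>0 complex"

definition Const :: "complex \<Rightarrow> cmpoly" where
  "Const c = Poly_Mapping.single 0 c"

definition Var :: "nat \<Rightarrow> cmpoly" where
  "Var i = Poly_Mapping.single (Poly_Mapping.single i 1) 1"

definition polys_in :: "nat set \<Rightarrow> cmpoly set" where
  "polys_in V = {p. \<forall>m \<in> Poly_Mapping.keys p. Poly_Mapping.keys m \<subseteq> V}"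

definition eval_cmpoly :: "(nat \<Rightarrow> complex) \<Rightarrow> cmpoly \<Rightarrow> complex" where
  "eval_cmpoly z p =
     (\<Sum>m \<in> Poly_Mapping.keys p.
        Poly_Mapping.lookup p m * (\<Prod>i \<in> Poly_Mapping.keys m. z i ^ Poly_Mapping.lookup m i))"

text \<open>
  The variables are numbered from 1 to \<open>n\<close>. A point is a function on all of \<open>nat\<close>, of which
  polynomials in these variables only see the values on \<open>{1..n}\<close>.
\<close>

definition stable_polys :: "nat \<Rightarrow> cmpoly set" where
  "stable_polys n =
     {p \<in> polys_in {1..n}. \<forall>z. (\<forall>j \<in> {1..n}. Im (z j) > 0) \<longrightarrow> eval_cmpoly z p \<noteq> 0}"

definition real_rooted_polys :: "real poly set" where
  "real_rooted_polys =
     {p. p \<noteq> 0 \<and> (\<forall>z :: complex. poly (map_poly complex_of_real p) z = 0 \<longrightarrow> z \<in> \<real>)}"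

end

(*
  Fix z_1, ..., z_n in the open upper half-plane H and let g(w) = F(w, z_2, ..., z_n), which has no
  zeros in H. The polynomial in the conclusion is f(z_1 d/dw) g evaluated at w = 0. Writing f as a
  product of factors x + alpha, it is enough to treat the operator alpha + z_1 d/dw: by the
  Gauss-Lucas argument g'/g has nonpositive imaginary part on H, whereas -alpha/z_1 has positive
  imaginary part when alpha > 0, so that alpha g + z_1 g' has no zeros in H either. To get alpha > 0
  and to reach the boundary point w = 0, shift all zeros of f by -eps, evaluate at w = i eps, and
  let eps tend to 0. Hurwitz' theorem, applied on a complex line, shows that the limit is stable
  or zero.
*)
theory Submission
  imports Defs "HOL-Complex_Analysis.Great_Picard"
    "HOL-Computational_Algebra.Fundamental_Theorem_Algebra"
begin

section \<open>Evaluation as a ring homomorphism\<close>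

definition eval_monom :: "(nat \<Rightarrow> complex) \<Rightarrow> (nat \<Rightarrow>\<^sub>0 nat) \<Rightarrow> complex" where
  "eval_monom z m = (\<Prod>i\<in>Poly_Mapping.keys m. z i ^ Poly_Mapping.lookup m i)"

lemma eval_monom_superset:
  assumes "finite S" "Poly_Mapping.keys m \<subseteq> S"
  shows "eval_monom z m = (\<Prod>i\<in>S. z i ^ Poly_Mapping.lookup m i)"
  unfolding eval_monom_def using assms
  by (intro prod.mono_neutral_left) (auto simp: in_keys_iff)

lemma eval_monom_add: "eval_monom z (m + m') = eval_monom z m * eval_monom z m'"
proof -
  let ?S = "Poly_Mapping.keys m \<union> Poly_Mapping.keys m'"
  have "eval_monom z (m + m') = (\<Prod>i\<in>?S. z i ^ Poly_Mapping.lookup (m + m') i)"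
    by (rule eval_monom_superset) (use keys_add[of m m'] in auto)
  also have "\<dots> = (\<Prod>i\<in>?S. z i ^ Poly_Mapping.lookup m i) * (\<Prod>i\<in>?S. z i ^ Poly_Mapping.lookup m' i)"
    by (simp add: lookup_add power_add prod.distrib)
  also have "\<dots> = eval_monom z m * eval_monom z m'"
    by (simp add: eval_monom_superset[of ?S])
  finally show ?thesis .
qed

lemma eval_cmpoly_altdef:
  "eval_cmpoly z p = (\<Sum>m\<in>Poly_Mapping.keys p. Poly_Mapping.lookup p m * eval_monom z m)"
  by (simp add: eval_cmpoly_def eval_monom_def)

lemma eval_cmpoly_zero [simp]: "eval_cmpoly z 0 = 0"
  by (simp add: eval_cmpoly_def)

lemma eval_cmpoly_single: "eval_cmpoly z (Poly_Mapping.single m c) = c * eval_monom z m"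
  by (cases "c = 0") (auto simp: eval_cmpoly_altdef)

lemma eval_cmpoly_add: "eval_cmpoly z (p + q) = eval_cmpoly z p + eval_cmpoly z q"
  unfolding eval_cmpoly_altdef
  by (rule setsum_keys_plus_distrib[where f = "\<lambda>m c. c * eval_monom z m"])
     (auto simp: algebra_simps)

lemma eval_cmpoly_sum: "eval_cmpoly z (\<Sum>i\<in>I. p i) = (\<Sum>i\<in>I. eval_cmpoly z (p i))"
  by (induction I rule: infinite_finite_induct) (auto simp: eval_cmpoly_add)

lemma cmpoly_eq_sum_single:
  "(p :: cmpoly) = (\<Sum>m\<in>Poly_Mapping.keys p. Poly_Mapping.single m (Poly_Mapping.lookup p m))"
proof (rule poly_mapping_eqI)
  fix k
  have "Poly_Mapping.lookup p k = (\<Sum>m\<in>Poly_Mapping.keys p. if k = m then Poly_Mapping.lookup p m else 0)"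
    by (subst sum.delta') (auto simp: in_keys_iff)
  then show "Poly_Mapping.lookup p k =
      Poly_Mapping.lookup (\<Sum>m\<in>Poly_Mapping.keys p. Poly_Mapping.single m (Poly_Mapping.lookup p m)) k"
    by (simp add: lookup_sum lookup_single when_def eq_commute)
qed

lemma eval_cmpoly_mult: "eval_cmpoly z (p * q) = eval_cmpoly z p * eval_cmpoly z q"
proof -
  have "p * q = (\<Sum>m\<in>Poly_Mapping.keys p. \<Sum>m'\<in>Poly_Mapping.keys q.
          Poly_Mapping.single (m + m') (Poly_Mapping.lookup p m * Poly_Mapping.lookup q m'))"
    by (subst (1) cmpoly_eq_sum_single[of p], subst (1) cmpoly_eq_sum_single[of q])
       (simp add: sum_product mult_single)
  also have "eval_cmpoly z \<dots> = eval_cmpoly z p * eval_cmpoly z q"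
    unfolding eval_cmpoly_altdef[of z p] eval_cmpoly_altdef[of z q]
    by (simp add: eval_cmpoly_sum eval_cmpoly_single eval_monom_add sum_product mult_ac)
  finally show ?thesis .
qed

lemma eval_cmpoly_Const [simp]: "eval_cmpoly z (Const c) = c"
  by (simp add: Const_def eval_cmpoly_single eval_monom_def)

lemma eval_cmpoly_Var [simp]: "eval_cmpoly z (Var i) = z i"
  by (simp add: Var_def eval_cmpoly_single eval_monom_def)

lemma eval_cmpoly_Var_power [simp]: "eval_cmpoly z (Var i ^ k) = z i ^ k"
proof (induction k)
  case 0
  show ?case
    using eval_cmpoly_Const[of z 1] by (simp add: Const_def)
qed (simp add: eval_cmpoly_mult)

lemma eval_cmpoly_cong:
  assumes "p \<in> polys_in V" "\<And>i. i \<in> V \<Longrightarrow> z i = z' i"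
  shows "eval_cmpoly z p = eval_cmpoly z' p"
  using assms unfolding eval_cmpoly_def polys_in_def
  by (intro sum.cong refl arg_cong2[where f = "(*)"] prod.cong arg_cong2[where f = "(^)"]) blast+

lemma holomorphic_on_eval_cmpoly:
  assumes "\<And>i. (\<lambda>t. z t i) holomorphic_on S"
  shows "(\<lambda>t. eval_cmpoly (z t) p) holomorphic_on S"
  unfolding eval_cmpoly_def by (intro holomorphic_intros assms)

section \<open>Closure of the polynomials in a given set of variables\<close>

lemma polys_in_mono: "V \<subseteq> W \<Longrightarrow> polys_in V \<subseteq> polys_in W"
  by (auto simp: polys_in_def)

lemma polys_in_Const: "Const c \<in> polys_in V"
  by (auto simp: polys_in_def Const_def split: if_splits)

lemma polys_in_Var: "i \<in> V \<Longrightarrow> Var i \<in> polys_in V"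
  by (auto simp: polys_in_def Var_def)

lemma polys_in_mult:
  assumes "p \<in> polys_in V" "q \<in> polys_in V"
  shows "p * q \<in> polys_in V"
  unfolding polys_in_def
proof (intro CollectI ballI)
  fix m assume "m \<in> Poly_Mapping.keys (p * q)"
  then obtain a b where "m = a + b" "a \<in> Poly_Mapping.keys p" "b \<in> Poly_Mapping.keys q"
    using keys_mult[of p q] by blast
  then show "Poly_Mapping.keys m \<subseteq> V"
    using assms keys_add[of a b] unfolding polys_in_def by blast
qed

lemma polys_in_power: "p \<in> polys_in V \<Longrightarrow> p ^ k \<in> polys_in V"
proof (induction k)
  case 0
  show ?case
    using polys_in_Const[of 1] by (simp add: Const_def)
qed (simp add: polys_in_mult)

lemma polys_in_sum: "(\<And>i. i \<in> I \<Longrightarrow> p i \<in> polys_in V) \<Longrightarrow> (\<Sum>i\<in>I. p i) \<in> polys_in V"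
  using keys_sum[of p I] unfolding polys_in_def by blast

text \<open>
  Substituting the \<open>k\<close>-th powers of distinct primes sends the monomials \<open>m\<close> to \<open>N m ^ k\<close> for
  distinct naturals \<open>N m\<close>. A polynomial \<open>p\<close> vanishing at all these points therefore satisfies
  \<open>(\<Sum>m. lookup p m * poly q (N m)) = 0\<close> for every univariate \<open>q\<close>; taking for \<open>q\<close> an
  interpolation polynomial isolates one coefficient.
\<close>
lemma cmpoly_nonzero_value:
  assumes "p \<noteq> 0"
  obtains y where "eval_cmpoly y p \<noteq> 0"
proof -
  define P where "P = enumerate {p :: nat. prime p}"
  have P: "inj P" "\<And>i. prime (P i)"
    using strict_mono_enumerate[OF primes_infinite] enumerate_in_set[OF primes_infinite]
    by (auto simp: P_def strict_mono_imp_inj_on)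
  define N where "N m = (\<Prod>i\<in>Poly_Mapping.keys m. P i ^ Poly_Mapping.lookup m i)" for m
  \<comment> \<open>Unique factorization reads the exponents of \<open>m\<close> off
    \<open>N m\<close>, so \<open>N\<close> is injective.\<close>
  have mult: "multiplicity (P i) (N m) = Poly_Mapping.lookup m i" for i m
  proof -
    have "N m = (\<Prod>q\<in>P ` Poly_Mapping.keys m. q ^ Poly_Mapping.lookup m (inv P q))"
      unfolding N_def using P(1)
      by (subst prod.reindex) (auto intro: inj_on_subset)
    then have "multiplicity (P i) (N m) =
        (if P i \<in> P ` Poly_Mapping.keys m then Poly_Mapping.lookup m (inv P (P i)) else 0)"
      using P(2) by (simp only:) (rule multiplicity_prod_prime_powers, auto)
    then show ?thesis
      using P(1) by (auto simp: in_keys_iff inj_image_mem_iff)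
  qed
  have inj: "m = m'" if "N m = N m'" for m m'
    by (rule poly_mapping_eqI) (metis that mult)
  from assms obtain m0 where m0: "m0 \<in> Poly_Mapping.keys p"
    by (metis keys_eq_empty ex_in_conv)
  define y :: "nat \<Rightarrow> nat \<Rightarrow> complex" where "y k i = of_nat (P i) ^ k" for k i
  have mon: "eval_monom (y k) m = of_nat (N m) ^ k" for k m
    by (simp add: eval_monom_def y_def N_def prod_power_distrib flip: power_mult)
       (simp add: mult.commute)
  have "\<exists>k. eval_cmpoly (y k) p \<noteq> 0"
  proof (rule ccontr)
    assume "\<not> ?thesis"
    then have zero: "(\<Sum>m\<in>Poly_Mapping.keys p. Poly_Mapping.lookup p m * of_nat (N m) ^ k) = 0" for k
      by (simp add: eval_cmpoly_altdef mon)
    have q0: "(\<Sum>m\<in>Poly_Mapping.keys p. Poly_Mapping.lookup p m * poly q (of_nat (N m))) = 0" for q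
    proof -
      have "(\<Sum>m\<in>Poly_Mapping.keys p. Poly_Mapping.lookup p m * poly q (of_nat (N m))) =
          (\<Sum>k\<le>Polynomial.degree q. \<Sum>m\<in>Poly_Mapping.keys p.
             coeff q k * (Poly_Mapping.lookup p m * of_nat (N m) ^ k))"
        by (subst sum.swap) (simp add: poly_altdef sum_distrib_left mult_ac)
      also have "\<dots> = 0"
        by (simp add: zero flip: sum_distrib_left)
      finally show ?thesis .
    qed
    define q :: "complex poly"
      where "q = (\<Prod>m\<in>Poly_Mapping.keys p - {m0}. [:- of_nat (N m), 1:])"
    have "poly q (of_nat (N m)) = 0" if "m \<in> Poly_Mapping.keys p - {m0}" for m
      using that unfolding q_def poly_prod by (intro prod_zero) auto
    then have "(\<Sum>m\<in>Poly_Mapping.keys p. Poly_Mapping.lookup p m * poly q (of_nat (N m))) =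
        Poly_Mapping.lookup p m0 * poly q (of_nat (N m0))"
      using m0 by (subst sum.remove[of _ m0]) auto
    moreover have "poly q (of_nat (N m0)) \<noteq> 0"
      using inj by (auto simp: q_def poly_prod)
    ultimately show False
      using q0[of q] m0 by (auto simp: in_keys_iff)
  qed
  then show ?thesis
    using that by blast
qed

section \<open>Limits of stable polynomials\<close>

text \<open>Each \<open>h i\<close> is bounded on the compact set \<open>K\<close>, so convergence
  of the finitely many coefficients is enough. This supplies the locally uniform convergence that
  Hurwitz' theorem asks for.\<close>

lemma uniform_limit_sum_coeffs:
  fixes h :: "'i \<Rightarrow> 'a::topological_space \<Rightarrow> complex"
  assumes "finite I" "compact K" "\<And>i. i \<in> I \<Longrightarrow> continuous_on K (h i)"
    and "\<And>i. i \<in> I \<Longrightarrow> (\<lambda>N. c N i) \<longlonglongrightarrow> c' i"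
  shows "uniform_limit K (\<lambda>N t. \<Sum>i\<in>I. c N i * h i t) (\<lambda>t. \<Sum>i\<in>I. c' i * h i t) sequentially"
  using assms(1,3,4)
proof (induction I)
  case empty
  show ?case by (simp add: uniform_limit_const)
next
  case (insert i I)
  have "uniform_limit K (\<lambda>N t. c N i) (\<lambda>t. c' i) sequentially"
    using insert.prems(2)[of i] by (auto simp: uniform_limit_iff tendsto_iff)
  moreover have "bounded (h i ` K)"
    using insert.prems(1)[of i] assms(2) by (simp add: compact_continuous_image compact_imp_bounded)
  moreover have "bounded ((\<lambda>t. c' i) ` K)"
    by (auto intro: finite_imp_bounded finite_subset[of _ "{c' i}"])
  ultimately have "uniform_limit K (\<lambda>N t. c N i * h i t) (\<lambda>t. c' i * h i t) sequentially"
    by (intro uniform_lim_mult uniform_limit_const) auto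
  then show ?case
    using insert by (auto intro!: uniform_limit_add)
qed

text \<open>Hurwitz' theorem is one-dimensional, so a supposed zero \<open>z\<close> of the limit is
  studied on the complex line joining it to a point \<open>y\<close> where the limit does not
  vanish. Near \<open>z\<close> the approximants have no zeros, hence neither has the limit, unless
  it is constant there.\<close>

lemma stable_polys_limit:
  assumes "finite I" "\<And>i. i \<in> I \<Longrightarrow> p i \<in> polys_in {1..n}"
    and lim: "\<And>i. i \<in> I \<Longrightarrow> (\<lambda>N. c N i) \<longlonglongrightarrow> c' i"
    and nz: "\<And>N z. (\<forall>j\<in>{1..n}. Im (z j) > 0) \<Longrightarrow> (\<Sum>i\<in>I. c N i * eval_cmpoly z (p i)) \<noteq> 0"
  shows "(\<Sum>i\<in>I. Const (c' i) * p i) \<in> stable_polys n \<union> {0}"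
proof (rule ccontr)
  define q where "q = (\<Sum>i\<in>I. Const (c' i) * p i)"
  assume "\<not> ?thesis"
  then have "q \<noteq> 0" "q \<notin> stable_polys n"
    by (auto simp: q_def)
  moreover have "q \<in> polys_in {1..n}"
    unfolding q_def using assms(2) by (intro polys_in_sum polys_in_mult polys_in_Const)
  ultimately obtain z where z: "\<And>j. j \<in> {1..n} \<Longrightarrow> Im (z j) > 0" "eval_cmpoly z q = 0"
    unfolding stable_polys_def by blast
  obtain y where y: "eval_cmpoly y q \<noteq> 0"
    using cmpoly_nonzero_value[OF \<open>q \<noteq> 0\<close>] .
  \<comment> \<open>Only small \<open>t\<close> has to keep the line in the product of half-planes;
    \<open>y\<close> itself may lie outside.\<close>
  define l where "l t i = z i + t * (y i - z i)" for t i
  have l: "l 0 = z" "l 1 = y"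
    by (auto simp: l_def)
  have hol: "(\<lambda>t. eval_cmpoly (l t) p') holomorphic_on S" for p' S
    unfolding l_def by (intro holomorphic_on_eval_cmpoly holomorphic_intros)
  have q: "eval_cmpoly (l t) q = (\<Sum>i\<in>I. c' i * eval_cmpoly (l t) (p i))" for t
    by (simp add: q_def eval_cmpoly_sum eval_cmpoly_mult)
  have "{t. \<forall>j\<in>{1..n}. Im (l t j) > 0} = (\<Inter>j\<in>{1..n}. {t. Im (l t j) > 0})"
    by auto
  moreover have "open (\<Inter>j\<in>{1..n}. {t. Im (l t j) > 0})"
    unfolding l_def by (intro open_INT ballI open_Collect_less continuous_intros) auto
  ultimately have "open {t. \<forall>j\<in>{1..n}. Im (l t j) > 0}"
    by (simp only:)
  moreover have "0 \<in> {t. \<forall>j\<in>{1..n}. Im (l t j) > 0}"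
    using z by (simp add: l)
  ultimately obtain e where e: "e > 0" "ball 0 e \<subseteq> {t. \<forall>j\<in>{1..n}. Im (l t j) > 0}"
    using open_contains_ball by blast
  have "eval_cmpoly (l 0) q \<noteq> 0"
  proof (rule Hurwitz_no_zeros[of "ball 0 e" "\<lambda>N t. \<Sum>i\<in>I. c N i * eval_cmpoly (l t) (p i)"
        "\<lambda>t. eval_cmpoly (l t) q"])
    show "(\<lambda>t. \<Sum>i\<in>I. c N i * eval_cmpoly (l t) (p i)) holomorphic_on ball 0 e" for N
      by (intro holomorphic_intros hol)
    show "uniform_limit K (\<lambda>N t. \<Sum>i\<in>I. c N i * eval_cmpoly (l t) (p i))
        (\<lambda>t. eval_cmpoly (l t) q) sequentially" if "compact K" for K
      unfolding q using assms(1) that lim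
      by (intro uniform_limit_sum_coeffs) (auto intro: holomorphic_on_imp_continuous_on hol)
    show "(\<Sum>i\<in>I. c N i * eval_cmpoly (l t) (p i)) \<noteq> 0" if "t \<in> ball 0 e" for N t
      using nz[of "l t" N] that e(2) by blast
    \<comment> \<open>A constant restriction would be 0, its value at \<open>z\<close>; by the
      identity theorem it would vanish on the whole line, including at \<open>y\<close>.\<close>
    show "\<not> (\<lambda>t. eval_cmpoly (l t) q) constant_on ball 0 e"
    proof
      assume "(\<lambda>t. eval_cmpoly (l t) q) constant_on ball 0 e"
      moreover have "0 \<in> ball (0 :: complex) e"
        using e(1) by simp
      ultimately have zero: "eval_cmpoly (l t) q = 0" if "t \<in> ball 0 e" for t
        using that z(2) unfolding constant_on_def by (metis l(1))
      have "eval_cmpoly (l 1) q = 0"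
      proof (rule analytic_continuation_open[where f = "\<lambda>t. eval_cmpoly (l t) q" and g = "\<lambda>_. 0"])
        show "ball (0 :: complex) e \<noteq> {}"
          using e(1) by simp
        show "eval_cmpoly (l t) q = 0" if "t \<in> ball 0 e" for t
          using zero[OF that] .
      qed (rule open_ball open_UNIV connected_UNIV subset_UNIV hol holomorphic_on_const UNIV_I)+
      with y show False
        by (simp add: l)
    qed
  qed (use e hol in auto)
  with z(2) show False
    by (simp add: l)
qed

section \<open>Logarithmic derivatives on the upper half-plane\<close>

text \<open>The quotient is the sum of \<open>1 / (w - x)\<close> over the zeros \<open>x\<close> of
  \<open>g\<close>. Since \<open>Im x \<le> 0 < Im w\<close>, every summand has negative imaginary
  part. The sum is built by induction on the multiset of zeros.\<close>

lemma Im_logderiv_nonpos: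
  fixes g :: "complex poly"
  assumes "\<And>w. Im w > 0 \<Longrightarrow> poly g w \<noteq> 0" "Im w > 0"
  shows "Im (poly (pderiv g) w / poly g w) \<le> 0"
proof -
  have "Im (poly (pderiv (smult a (\<Prod>x\<in>#A. [:-x, 1:]))) w / poly (smult a (\<Prod>x\<in>#A. [:-x, 1:])) w) \<le> 0"
    if "a \<noteq> 0" "\<And>x. x \<in># A \<Longrightarrow> Im x \<le> 0" for A a
    using that(2)
  proof (induction A)
    case empty
    show ?case by simp
  next
    case (add x A)
    define P where "P = (\<Prod>x\<in>#A. [:-x, 1:])"
    have nz: "poly P w \<noteq> 0"
      using add.prems assms(2) unfolding P_def poly_prod_mset by (fastforce simp: prod_mset_zero_iff)
    have x: "w - x \<noteq> 0" "Im x \<le> 0"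
      using add.prems[of x] assms(2) by auto
    have "poly (pderiv (smult a ([:-x, 1:] * P))) w / poly (smult a ([:-x, 1:] * P)) w =
        1 / (w - x) + poly (pderiv (smult a P)) w / poly (smult a P) w"
    proof -
      have "pderiv (smult a ([:-x, 1:] * P)) = smult a (P + [:-x, 1:] * pderiv P)"
        by (simp only: pderiv_smult pderiv_mult) (simp add: pderiv_pCons add_ac)
      then have "poly (pderiv (smult a ([:-x, 1:] * P))) w = a * (poly P w + (w - x) * poly (pderiv P) w)"
        by (simp add: algebra_simps)
      moreover have "poly (smult a ([:-x, 1:] * P)) w = a * ((w - x) * poly P w)"
        by (simp add: algebra_simps)
      ultimately show ?thesis
        using nz x(1) that(1) by (simp add: pderiv_smult add_divide_distrib)
    qed
    moreover have "Im (1 / (w - x)) \<le> 0"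
      using x assms(2) by (simp add: Im_divide divide_le_0_iff)
    ultimately show ?case
      using add by (simp add: P_def)
  qed
  moreover obtain A where A: "g = smult (lead_coeff g) (\<Prod>x\<in>#A. [:-x, 1:])"
    using alg_closed_imp_factorization[of g] assms by force
  moreover have "lead_coeff g \<noteq> 0"
    using assms by force
  moreover have "Im x \<le> 0" if "x \<in># A" for x
  proof (rule ccontr)
    assume "\<not> ?thesis"
    then have "poly g x \<noteq> 0"
      using assms by auto
    moreover have "poly g x = 0"
      using that by (subst A) (auto simp: poly_prod_mset)
    ultimately show False by simp
  qed
  ultimately show ?thesis
    by metis
qed

text \<open>At a zero, \<open>g'/g\<close> would equal \<open>- b / z\<close>, whose imaginary part
  is \<open>b * Im z / |z|^2 > 0\<close>.\<close>

lemma zero_free_smult_add_pderiv: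
  fixes g :: "complex poly"
  assumes "\<And>w. Im w > 0 \<Longrightarrow> poly g w \<noteq> 0" "Im z > 0" "Im b = 0" "Re b > 0" "Im w > 0"
  shows "poly (smult b g + smult z (pderiv g)) w \<noteq> 0"
proof
  assume *: "poly (smult b g + smult z (pderiv g)) w = 0"
  have "poly g w \<noteq> 0" "z \<noteq> 0"
    using assms by auto
  with * have "poly (pderiv g) w / poly g w = - b / z"
    by (simp add: field_simps add_eq_0_iff)
  moreover have "Im (- b / z) > 0"
    using assms by (simp add: Im_divide divide_pos_pos sum_power2_gt_zero_iff mult_pos_pos)
  ultimately show False
    using Im_logderiv_nonpos[of g w] assms by auto
qed

section \<open>Differential operators that preserve zero-freeness\<close>

lemma smult_sum_right: "smult c (\<Sum>i\<in>I. p i) = (\<Sum>i\<in>I. smult c (p i))"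
  by (induction I rule: infinite_finite_induct) (simp_all add: smult_add_right)

text \<open>The operator \<open>p (z d/dw)\<close>.\<close>
definition diffop :: "complex \<Rightarrow> complex poly \<Rightarrow> complex poly \<Rightarrow> complex poly" where
  "diffop z p g = (\<Sum>k\<le>Polynomial.degree p. smult (coeff p k * z ^ k) ((pderiv ^^ k) g))"

text \<open>Coefficients beyond the degree vanish, so one summation bound can serve a whole family
  of polynomials.\<close>

lemma diffop_altdef:
  assumes "Polynomial.degree p \<le> N"
  shows "diffop z p g = (\<Sum>k\<le>N. smult (coeff p k * z ^ k) ((pderiv ^^ k) g))"
  unfolding diffop_def using assms
  by (intro sum.mono_neutral_left) (auto simp: coeff_eq_0)

text \<open>A linear factor of the symbol acts as \<open>b + z d/dw\<close> because \<open>z\<close>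
  is a constant for \<open>d/dw\<close>; thus a factorization of the symbol becomes a composition of
  first-order operators.\<close>

lemma diffop_linear_mult:
  "diffop z ([:b, 1:] * p) g = smult b (diffop z p g) + smult z (pderiv (diffop z p g))"
proof -
  define N where "N = Polynomial.degree p"
  have "diffop z ([:b, 1:] * p) g =
      (\<Sum>k\<le>Suc N. smult (coeff ([:b, 1:] * p) k * z ^ k) ((pderiv ^^ k) g))"
    by (rule diffop_altdef) (use degree_mult_le[of "[:b, 1:]" p] in \<open>simp add: N_def\<close>)
  also have "\<dots> = smult b (\<Sum>k\<le>Suc N. smult (coeff p k * z ^ k) ((pderiv ^^ k) g)) +
      (\<Sum>k\<le>Suc N. smult (coeff (pCons 0 p) k * z ^ k) ((pderiv ^^ k) g))"
    by (simp add: smult_sum_right smult_add_left algebra_simps sum.distrib del: sum.atMost_Suc)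
  \<comment> \<open>The extra term \<open>k = Suc N\<close> is zero, being beyond the degree of
    \<open>p\<close>.\<close>
  also have "(\<Sum>k\<le>Suc N. smult (coeff p k * z ^ k) ((pderiv ^^ k) g)) = diffop z p g"
    by (rule diffop_altdef[symmetric]) (simp add: N_def)
  \<comment> \<open>The term \<open>k = 0\<close> vanishes; shifting the index pulls out one factor
    \<open>z\<close> and one derivative.\<close>
  also have "(\<Sum>k\<le>Suc N. smult (coeff (pCons 0 p) k * z ^ k) ((pderiv ^^ k) g)) =
      smult z (pderiv (diffop z p g))"
    by (subst sum.atMost_Suc_shift)
       (simp add: diffop_def N_def higher_pderiv_sum[of 1, simplified] pderiv_smult smult_sum_right mult_ac)
  finally show ?thesis .
qed

text \<open>The linear factors are peeled off one at a time, with \<open>b = - x > 0\<close>. The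
  next step needs zero-freeness on the whole half-plane, so \<open>w\<close> varies in the
  induction.\<close>

lemma diffop_prod_zero_free:
  assumes "\<And>w. Im w > 0 \<Longrightarrow> poly g w \<noteq> 0" "Im z > 0"
    and "\<And>x. x \<in># A \<Longrightarrow> Im x = 0 \<and> Re x < 0" "Im w > 0"
  shows "poly (diffop z (\<Prod>x\<in>#A. [:-x, 1:]) g) w \<noteq> 0"
  using assms(3,4)
proof (induction A arbitrary: w)
  case empty
  then show ?case using assms by (simp add: diffop_def)
next
  case (add x A)
  have "poly (smult (- x) (diffop z (\<Prod>x\<in>#A. [:-x, 1:]) g) +
      smult z (pderiv (diffop z (\<Prod>x\<in>#A. [:-x, 1:]) g))) w \<noteq> 0"
    using add assms(2) by (intro zero_free_smult_add_pderiv) auto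
  then show ?case
    by (simp only: image_mset_add_mset prod_mset.add_mset diffop_linear_mult not_False_eq_True)
qed

lemma diffop_smult: "diffop z (smult a p) g = smult a (diffop z p g)"
  by (cases "a = 0") (simp_all add: diffop_def smult_sum_right mult_ac)

section \<open>Perturbing the zeros of a split polynomial\<close>

lemma degree_prod_mset_linear: "Polynomial.degree (\<Prod>x\<in>#A. [:u x, 1 :: complex:]) = size A"
proof (induction A)
  case (add x A)
  have "(\<Prod>x\<in>#A. [:u x, 1:]) \<noteq> 0"
    by auto
  then show ?case
    using add by (simp add: degree_mult_eq del: mult_pCons_left)
qed auto

text \<open>Coefficients depend continuously on the zeros: coefficient \<open>k\<close> of
  \<open>[:u, 1:] * P\<close> is \<open>u * coeff P k + coeff P (k - 1)\<close>, the second term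
  being absent for \<open>k = 0\<close>.\<close>

lemma tendsto_coeff_prod_linear:
  fixes e :: "nat \<Rightarrow> complex"
  assumes "e \<longlonglongrightarrow> 0"
  shows "(\<lambda>N. coeff (\<Prod>x\<in>#A. [:- (x - e N), 1:]) k)
    \<longlonglongrightarrow> coeff (\<Prod>x\<in>#A. [:-x, 1:]) k"
proof (induction A arbitrary: k)
  case (add x A)
  have "(\<lambda>N. - (x - e N)) \<longlonglongrightarrow> - (x - 0)"
    by (intro tendsto_intros assms)
  then have e: "(\<lambda>N. e N - x) \<longlonglongrightarrow> - x"
    by simp
  have IH: "(\<lambda>N. coeff (\<Prod>x\<in>#A. [:e N - x, 1:]) k) \<longlonglongrightarrow> coeff (\<Prod>x\<in>#A. [:-x, 1:]) k" for k
    using add.IH[of k] by simp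
  show ?case
  proof (cases k)
    case 0
    then show ?thesis
      using tendsto_mult[OF e IH[of 0]] by simp
  next
    case (Suc j)
    then show ?thesis
      using tendsto_add[OF tendsto_mult[OF e IH[of k]] IH[of j]] by simp
  qed
qed auto

text \<open>The source of the factor \<open>k!\<close> in the theorem.\<close>

lemma poly_higher_pderiv_0: "poly ((pderiv ^^ k) p) 0 = fact k * coeff p k"
  by (simp add: poly_0_coeff_0 coeff_higher_pderiv pochhammer_fact)

text \<open>Over the complex numbers \<open>f\<close> splits; real-rootedness makes each zero real,
  and the sign hypothesis on real zeros then applies to it.\<close>

lemma real_rooted_nonpos_factorization:
  assumes "f \<in> real_rooted_polys" "\<And>x. poly f x = 0 \<Longrightarrow> x \<le> 0"
  obtains b A where "b \<noteq> 0" "map_poly complex_of_real f = smult b (\<Prod>x\<in>#A. [:-x, 1:])"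
    "size A = Polynomial.degree f" "\<And>x. x \<in># A \<Longrightarrow> Im x = 0 \<and> Re x \<le> 0"
proof -
  let ?f = "map_poly complex_of_real f"
  have f: "f \<noteq> 0" "\<And>z. poly ?f z = 0 \<Longrightarrow> z \<in> \<real>"
    using assms(1) by (auto simp: real_rooted_polys_def)
  have f0: "?f \<noteq> 0"
    using f(1) by (simp add: map_poly_eq_0_iff)
  obtain A where A: "size A = Polynomial.degree ?f" "?f = smult (lead_coeff ?f) (\<Prod>x\<in>#A. [:-x, 1:])"
    using alg_closed_imp_factorization[OF f0] by blast
  have ev: "poly ?f (of_real x) = of_real (poly f x)" for x
    by (induction f) (auto simp: map_poly_pCons)
  have "Im x = 0 \<and> Re x \<le> 0" if "x \<in># A" for x
  proof -
    have *: "poly ?f x = 0"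
      using that by (subst A(2)) (auto simp: poly_prod_mset)
    then obtain y where "x = of_real y"
      using f(2) by (auto elim: Reals_cases)
    then show ?thesis
      using * assms(2)[of y] by (simp add: ev)
  qed
  then show ?thesis
    using that[of "lead_coeff ?f" A] A f0 leading_coeff_neq_0[OF f0]
    by (simp add: degree_map_poly del: leading_coeff_0_iff)
qed

theorem theorem3p11:
  fixes n r s m :: nat
    and a :: "nat \<Rightarrow> real"
    and f :: "real poly"
    and Q :: "nat \<Rightarrow> cmpoly"
    and F :: cmpoly
  assumes "n \<ge> 1"
    and "f = (\<Sum>i\<le>r. monom (a i) i)"
    and "f \<in> real_rooted_polys"
    and "\<And>x. poly f x = 0 \<Longrightarrow> x \<le> 0"
    and "\<And>j. j \<le> s \<Longrightarrow> Q j \<in> polys_in {2..n}"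
    and "F = (\<Sum>j\<le>s. Q j * Var 1 ^ j)"
    and "F \<in> stable_polys n"
    and "m = min r s"
  shows "(\<Sum>k\<le>m. Const (fact k * complex_of_real (a k)) * Q k * Var 1 ^ k)
           \<in> stable_polys n \<union> {0}"
proof -
  let ?f = "map_poly complex_of_real f"
  have coeff_f: "coeff ?f k = of_real (a k)" if "k \<le> r" for k
    using that by (simp add: coeff_map_poly assms(2) coeff_sum)
  obtain b A where A: "b \<noteq> 0" "?f = smult b (\<Prod>x\<in>#A. [:-x, 1:])"
    "size A = Polynomial.degree f" "\<And>x. x \<in># A \<Longrightarrow> Im x = 0 \<and> Re x \<le> 0"
    using real_rooted_nonpos_factorization[OF assms(3,4)] by blast
  \<comment> \<open>Only an inequality, since \<open>a r\<close> may be 0.\<close>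
  have "Polynomial.degree f \<le> r"
    unfolding assms(2) by (rule degree_sum_le) (auto intro: order_trans[OF degree_monom_le])
  \<comment> \<open>The same null sequence serves as the shift of the zeros and as the height of the
    evaluation point \<open>\<i> * e N\<close>.\<close>
  define e :: "nat \<Rightarrow> complex" where "e N = of_real (inverse (real (Suc N)))" for N
  have e: "Im (e N) = 0" "Re (e N) > 0" for N
    by (auto simp: e_def)
  have e_lim: "e \<longlonglongrightarrow> 0"
    unfolding e_def using tendsto_of_real[OF LIMSEQ_inverse_real_of_nat, where 'a = complex] by simp
  define fN where "fN N = smult b (\<Prod>x\<in>#A. [:- (x - e N), 1:])" for N
  have fN_alt: "fN N = smult b (\<Prod>x\<in>#image_mset (\<lambda>x. x - e N) A. [:-x, 1:])" for N
    by (simp add: fN_def image_mset.compositionality comp_def)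
  have deg: "Polynomial.degree (fN N) \<le> r" for N
    using A(3) \<open>Polynomial.degree f \<le> r\<close> degree_prod_mset_linear[of "\<lambda>x. - (x - e N)" A]
    by (simp add: fN_def)
  have fN_lim: "(\<lambda>N. coeff (fN N) k) \<longlonglongrightarrow> coeff ?f k" for k
    unfolding A(2) fN_def coeff_smult
    by (intro tendsto_intros tendsto_coeff_prod_linear e_lim)

  \<comment> \<open>The pair \<open>(k, j)\<close> stands for the \<open>k\<close>-th term of the
    operator applied to the monomial \<open>w^j\<close> of \<open>g\<close>. The polynomials
    \<open>p\<close> stay fixed and only the scalars depend on \<open>N\<close>: \<open>c N\<close>
    belongs to \<open>w = \<i> * e N\<close>, \<open>c'\<close> to the limit
    \<open>w = 0\<close>.\<close>
  define I where "I = {..r} \<times> {..s}"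
  define p where "p = (\<lambda>(k, j). Q j * Var 1 ^ k)"
  define c where "c N = (\<lambda>(k, j).
      coeff (fN N) k * poly ((pderiv ^^ k) (monom 1 j)) (\<i> * e N))" for N
  define c' where "c' = (\<lambda>(k, j). coeff ?f k * poly ((pderiv ^^ k) (monom 1 j)) 0)"
  have Q: "Q j \<in> polys_in {1..n}" if "j \<le> s" for j
    using assms(5)[OF that] polys_in_mono[of "{2..n}" "{1..n}"] by auto
  have "(\<Sum>i\<in>I. Const (c' i) * p i) \<in> stable_polys n \<union> {0}"
  proof (rule stable_polys_limit)
    show "finite I"
      by (simp add: I_def)
    show "p i \<in> polys_in {1..n}" if "i \<in> I" for i
      using that assms(1) Q by (auto simp: I_def p_def intro!: polys_in_mult polys_in_power polys_in_Var)
    show "(\<lambda>N. c N i) \<longlonglongrightarrow> c' i" for i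
    proof -
      have "(\<lambda>N. poly q (\<i> * e N)) \<longlonglongrightarrow> poly q (\<i> * 0)" for q :: "complex poly"
        by (intro tendsto_intros e_lim)
      then have poly_lim: "(\<lambda>N. poly q (\<i> * e N)) \<longlonglongrightarrow> poly q 0" for q :: "complex poly"
        by simp
      show ?thesis
        unfolding c_def c'_def case_prod_unfold by (intro tendsto_mult fN_lim poly_lim)
    qed
    show "(\<Sum>i\<in>I. c N i * eval_cmpoly z (p i)) \<noteq> 0" if z: "\<forall>j\<in>{1..n}. Im (z j) > 0" for N z
    proof -
      define g where "g = (\<Sum>j\<le>s. smult (eval_cmpoly z (Q j)) (monom 1 j))"
      have g: "poly g w \<noteq> 0" if "Im w > 0" for w
      proof -
        \<comment> \<open>Replacing the first coordinate by \<open>w\<close> leaves the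
          \<open>Q j\<close> unchanged, as they involve only variables from 2 on; so
          \<open>g\<close> is \<open>F\<close> as a polynomial in its first variable.\<close>
        have "eval_cmpoly (z(1 := w)) (Q j) = eval_cmpoly z (Q j)" if "j \<le> s" for j
          by (rule eval_cmpoly_cong[OF assms(5)[OF that]]) auto
        then have "poly g w = eval_cmpoly (z(1 := w)) F"
          by (simp add: g_def poly_sum poly_monom assms(6) eval_cmpoly_sum eval_cmpoly_mult)
        then show ?thesis
          using assms(7) z that by (auto simp: stable_polys_def)
      qed
      have "(\<Sum>i\<in>I. c N i * eval_cmpoly z (p i)) =
          (\<Sum>k\<le>r. coeff (fN N) k * z 1 ^ k * poly ((pderiv ^^ k) g) (\<i> * e N))"
        by (simp add: I_def c_def p_def g_def eval_cmpoly_mult higher_pderiv_sum higher_pderiv_smult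
            poly_sum sum_distrib_left mult_ac sum.cartesian_product')
      also have "\<dots> = poly (diffop (z 1) (fN N) g) (\<i> * e N)"
        by (simp add: diffop_altdef[OF deg] poly_sum)
      also have "\<dots> \<noteq> 0"
      proof -
        have "Im (z 1) > 0"
          using z assms(1) by auto
        \<comment> \<open>The shift makes even a zero of \<open>f\<close> at the origin strictly
          negative, as the operator lemma requires.\<close>
        moreover have "Im x = 0 \<and> Re x < 0" if "x \<in># image_mset (\<lambda>x. x - e N) A" for x
          using that A(4) e[of N] by fastforce
        ultimately have "poly (diffop (z 1) (\<Prod>x\<in>#image_mset (\<lambda>x. x - e N) A. [:-x, 1:]) g) (\<i> * e N) \<noteq> 0"
          using g e[of N] by (intro diffop_prod_zero_free) auto
        then show ?thesis
          using A(1) by (simp add: fN_alt diffop_smult)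
      qed
      finally show ?thesis .
    qed
  qed
  \<comment> \<open>At \<open>w = 0\<close> the \<open>k\<close>-th derivative of \<open>w^j\<close>
    is \<open>k!\<close> if \<open>j = k\<close> and 0 otherwise, so only the diagonal
    survives.\<close>
  also have "(\<Sum>i\<in>I. Const (c' i) * p i) =
      (\<Sum>i\<in>I. if fst i = snd i
         then Const (fact (fst i) * complex_of_real (a (fst i))) * Q (fst i) * Var 1 ^ fst i else 0)"
    by (intro sum.cong refl)
       (auto simp: I_def c'_def p_def poly_higher_pderiv_0 coeff_f Const_def mult_ac)
  also have "\<dots> = (\<Sum>k\<le>m. Const (fact k * complex_of_real (a k)) * Q k * Var 1 ^ k)"
  proof -
    \<comment> \<open>The diagonal of the rectangle \<open>{..r} \<times> {..s}\<close> ends at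
      \<open>min r s = m\<close>.\<close>
    have "\<dots> = (\<Sum>i\<in>(\<lambda>k. (k, k)) ` {..m}.
        Const (fact (fst i) * complex_of_real (a (fst i))) * Q (fst i) * Var 1 ^ fst i)"
      by (rule sum.mono_neutral_cong_right) (auto simp: I_def assms(8))
    then show ?thesis
      by (simp add: sum.reindex inj_on_def)
  qed
  finally show ?thesis .
qed

end
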